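(* Let $\mathcal X$ be an infinite dimensional complex Banach space and let $A\in B(\mathcal X)$. Let $L_A,R_A\in B(B(\mathcal X))$ be the operators $L_A(T)=AT$, $R_A(T)=TA$. Then $E_0(L_A)=E_0(R_A)=\emptyset$, and hence Weyl's theorem holds for both $L_A$ and $R_A$.
   Context: For a complex Banach space $\mathcal Z$, $B(\mathcal Z)$ is the Banach algebra of bounded linear operators on $\mathcal Z$. For $T\in B(\mathcal Z)$, $\sigma(T)$ is the spectrum, $T-\lambda$ means $T-\lambda I$, $\alpha(T)=\dim N(T)$, $\beta(T)=\dim \mathcal Z/R(T)$. $T$ is Weyl if $\alpha(T)=\beta(T)<\infty$; $\sigma_w(T)=\{\lambda\in\mathbb C: T-\lambda \text{ is not Weyl}\}$. For $K\subseteq \mathbb C$, $\mathrm{iso}\,K$ is the set of isolated points of $K$. $E_0(T)=\{\lambda\in\mathrm{iso}\,\sigma(T): 0<\alpha(T-\lambda)<\infty\}$. Weyl's theorem holds for $T$ if $\sigma_w(T)=\sigma(T)\setminus E_0(T)$. *)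

theory Defs
  imports "HOL-Analysis.Analysis" "HOL-Library.Extended_Nat" "HOL-Library.Set_Algebras"
begin

section \<open>Complex normed spaces and complex Banach spaces\<close>

class complex_normed_vector = real_normed_vector +
  fixes scaleC :: "complex \<Rightarrow> 'a \<Rightarrow> 'a"  (infixr \<open>*\<^sub>C\<close> 75)
  assumes scaleC_add_right: "a *\<^sub>C (x + y) = a *\<^sub>C x + a *\<^sub>C y"
    and scaleC_add_left: "(a + b) *\<^sub>C x = a *\<^sub>C x + b *\<^sub>C x"
    and scaleC_scaleC: "a *\<^sub>C (b *\<^sub>C x) = (a * b) *\<^sub>C x"
    and scaleC_one: "1 *\<^sub>C x = x"
    and scaleR_eq_scaleC: "r *\<^sub>R x = complex_of_real r *\<^sub>C x"
    and norm_scaleC: "norm (a *\<^sub>C x) = cmod a * norm x"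

class cbanach = complex_normed_vector + banach

global_interpretation cvec: vector_space "scaleC :: complex \<Rightarrow> 'a \<Rightarrow> 'a::complex_normed_vector"
  by standard (simp_all add: scaleC_add_right scaleC_add_left scaleC_scaleC scaleC_one)

instantiation complex :: cbanach
begin
definition scaleC_complex :: "complex \<Rightarrow> complex \<Rightarrow> complex"
  where "scaleC_complex = (*)"
instance
  by standard (auto simp: scaleC_complex_def algebra_simps norm_mult scaleR_conv_of_real)
end

section \<open>Bounded complex-linear operators with the operator norm\<close>

text \<open>A bounded complex-linear map is a bounded real-linear map that commutes with complex
  scalars; the vector space operations and the operator norm are those of \<^typ>\<open>'a \<Rightarrow>\<^sub>L 'b\<close>.\<close>

typedef (overloaded) ('a, 'b) cblinfun (\<open>(_ \<Rightarrow>\<^sub>C\<^sub>L /_)\<close> [22, 21] 21) =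
  "{f :: 'a::complex_normed_vector \<Rightarrow>\<^sub>L 'b::complex_normed_vector. \<forall>c x. f (c *\<^sub>C x) = c *\<^sub>C f x}"
  morphisms blinfun_of_cblinfun cblinfun_of_blinfun
  by (intro exI[of _ 0]) simp

setup_lifting type_definition_cblinfun

definition cblinfun_apply :: "('a::complex_normed_vector \<Rightarrow>\<^sub>C\<^sub>L 'b::complex_normed_vector) \<Rightarrow> 'a \<Rightarrow> 'b"
  where "cblinfun_apply T = blinfun_apply (blinfun_of_cblinfun T)"

declare [[coercion "cblinfun_apply ::
  ('a::complex_normed_vector \<Rightarrow>\<^sub>C\<^sub>L 'b::complex_normed_vector) \<Rightarrow> 'a \<Rightarrow> 'b"]]

lemma cblinfun_eqI: "(\<And>x. cblinfun_apply S x = cblinfun_apply T x) \<Longrightarrow> S = T"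
  unfolding cblinfun_apply_def by (metis blinfun_eqI blinfun_of_cblinfun_inject)

lemma cblinfun_apply_scaleC: "cblinfun_apply T (c *\<^sub>C x) = c *\<^sub>C cblinfun_apply T x"
  unfolding cblinfun_apply_def using blinfun_of_cblinfun[of T] by simp

lemma bounded_linear_cblinfun_apply: "bounded_linear (cblinfun_apply T)"
  unfolding cblinfun_apply_def by (rule blinfun.bounded_linear_right)

instantiation cblinfun :: (complex_normed_vector, complex_normed_vector) complex_normed_vector
begin

lift_definition zero_cblinfun :: "'a \<Rightarrow>\<^sub>C\<^sub>L 'b" is 0 by simp

lift_definition plus_cblinfun :: "('a \<Rightarrow>\<^sub>C\<^sub>L 'b) \<Rightarrow> ('a \<Rightarrow>\<^sub>C\<^sub>L 'b) \<Rightarrow> ('a \<Rightarrow>\<^sub>C\<^sub>L 'b)" is "(+)"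
  by (simp add: blinfun.add_left scaleC_add_right)

lift_definition minus_cblinfun :: "('a \<Rightarrow>\<^sub>C\<^sub>L 'b) \<Rightarrow> ('a \<Rightarrow>\<^sub>C\<^sub>L 'b) \<Rightarrow> ('a \<Rightarrow>\<^sub>C\<^sub>L 'b)" is "(-)"
  by (simp add: blinfun.diff_left cvec.scale_right_diff_distrib)

lift_definition uminus_cblinfun :: "('a \<Rightarrow>\<^sub>C\<^sub>L 'b) \<Rightarrow> ('a \<Rightarrow>\<^sub>C\<^sub>L 'b)" is uminus
  by (simp add: blinfun.minus_left cvec.scale_minus_right)

lift_definition scaleR_cblinfun :: "real \<Rightarrow> ('a \<Rightarrow>\<^sub>C\<^sub>L 'b) \<Rightarrow> ('a \<Rightarrow>\<^sub>C\<^sub>L 'b)" is scaleR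
  by (simp add: blinfun.scaleR_left scaleR_eq_scaleC scaleC_scaleC mult.commute)

lemma scaleC_blinfun_aux:
  "bounded_linear (\<lambda>x. c *\<^sub>C blinfun_apply (f :: 'a \<Rightarrow>\<^sub>L 'b) x)"
proof (rule bounded_linear_intro[where K = "norm f * cmod c"])
  show "norm (c *\<^sub>C blinfun_apply f x) \<le> norm x * (norm f * cmod c)" for x
    using mult_left_mono[OF norm_blinfun[of f x], of "cmod c"]
    by (simp add: norm_scaleC mult_ac)
  show "c *\<^sub>C blinfun_apply f (r *\<^sub>R x) = r *\<^sub>R c *\<^sub>C blinfun_apply f x" for r x
    by (simp only: blinfun.scaleR_right) (simp only: scaleR_eq_scaleC scaleC_scaleC mult.commute)
qed (simp add: blinfun.add_right scaleC_add_right)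

lift_definition scaleC_cblinfun :: "complex \<Rightarrow> ('a \<Rightarrow>\<^sub>C\<^sub>L 'b) \<Rightarrow> ('a \<Rightarrow>\<^sub>C\<^sub>L 'b)"
  is "\<lambda>c f. Blinfun (\<lambda>x. c *\<^sub>C blinfun_apply f x)"
  by (simp add: bounded_linear_Blinfun_apply[OF scaleC_blinfun_aux] scaleC_scaleC mult.commute)

lift_definition norm_cblinfun :: "('a \<Rightarrow>\<^sub>C\<^sub>L 'b) \<Rightarrow> real" is norm .

definition dist_cblinfun :: "('a \<Rightarrow>\<^sub>C\<^sub>L 'b) \<Rightarrow> ('a \<Rightarrow>\<^sub>C\<^sub>L 'b) \<Rightarrow> real"
  where "dist_cblinfun S T = norm (S - T)"

definition sgn_cblinfun :: "('a \<Rightarrow>\<^sub>C\<^sub>L 'b) \<Rightarrow> ('a \<Rightarrow>\<^sub>C\<^sub>L 'b)"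
  where "sgn_cblinfun T = inverse (norm T) *\<^sub>R T"

definition uniformity_cblinfun :: "(('a \<Rightarrow>\<^sub>C\<^sub>L 'b) \<times> ('a \<Rightarrow>\<^sub>C\<^sub>L 'b)) filter"
  where "uniformity_cblinfun = (INF e\<in>{0<..}. principal {(S, T). dist S T < e})"

definition open_cblinfun :: "('a \<Rightarrow>\<^sub>C\<^sub>L 'b) set \<Rightarrow> bool"
  where "open_cblinfun U = (\<forall>S\<in>U. \<forall>\<^sub>F (S', T) in uniformity. S' = S \<longrightarrow> T \<in> U)"

instance
proof
  fix S T V :: "'a \<Rightarrow>\<^sub>C\<^sub>L 'b" and r s :: real and c d :: complex and U :: "('a \<Rightarrow>\<^sub>C\<^sub>L 'b) set"
  note B = bounded_linear_Blinfun_apply[OF scaleC_blinfun_aux]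
  show "S + T + V = S + (T + V)" by transfer (simp add: algebra_simps)
  show "S + T = T + S" by transfer (simp add: algebra_simps)
  show "0 + S = S" by transfer simp
  show "- S + S = 0" by transfer simp
  show "S - T = S + - T" by transfer simp
  show "r *\<^sub>R (S + T) = r *\<^sub>R S + r *\<^sub>R T" by transfer (simp add: algebra_simps)
  show "(r + s) *\<^sub>R S = r *\<^sub>R S + s *\<^sub>R S" by transfer (simp add: algebra_simps)
  show "r *\<^sub>R s *\<^sub>R S = (r * s) *\<^sub>R S" by transfer simp
  show "1 *\<^sub>R S = S" by transfer simp
  show "dist S T = norm (S - T)" by (rule dist_cblinfun_def)
  show "sgn S = inverse (norm S) *\<^sub>R S" by (rule sgn_cblinfun_def)
  show "(uniformity :: (('a \<Rightarrow>\<^sub>C\<^sub>L 'b) \<times> ('a \<Rightarrow>\<^sub>C\<^sub>L 'b)) filter)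
      = (INF e\<in>{0<..}. principal {(S, T). dist S T < e})"
    by (rule uniformity_cblinfun_def)
  show "open U = (\<forall>S\<in>U. \<forall>\<^sub>F (S', T) in uniformity. S' = S \<longrightarrow> T \<in> U)"
    by (rule open_cblinfun_def)
  show "(norm S = 0) = (S = 0)" by transfer simp
  show "norm (S + T) \<le> norm S + norm T" by transfer (rule norm_triangle_ineq)
  show "norm (r *\<^sub>R S) = \<bar>r\<bar> * norm S" by transfer simp
  show "c *\<^sub>C (S + T) = c *\<^sub>C S + c *\<^sub>C T"
    by transfer (rule blinfun_eqI, simp only: B, simp add: B blinfun.add_left scaleC_add_right)
  show "(c + d) *\<^sub>C S = c *\<^sub>C S + d *\<^sub>C S"
    by transfer (rule blinfun_eqI, simp only: B, simp add: B blinfun.add_left scaleC_add_left)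
  show "c *\<^sub>C d *\<^sub>C S = (c * d) *\<^sub>C S"
    by transfer (rule blinfun_eqI, simp only: B, simp add: B scaleC_scaleC)
  show "1 *\<^sub>C S = S"
    by transfer (rule blinfun_eqI, simp only: B, simp add: B scaleC_one)
  show "r *\<^sub>R S = complex_of_real r *\<^sub>C S"
    by transfer (rule blinfun_eqI, simp only: B, simp add: B blinfun.scaleR_left scaleR_eq_scaleC)
  show "norm (c *\<^sub>C S) = cmod c * norm S"
  proof transfer
    fix c and f :: "'a \<Rightarrow>\<^sub>L 'b"
    let ?g = "\<lambda>c f. Blinfun (\<lambda>x. c *\<^sub>C blinfun_apply f x) :: 'a \<Rightarrow>\<^sub>L 'b"
    have le: "norm (?g c f) \<le> cmod c * norm f" for c f
      by (rule norm_blinfun_bound)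
        (auto simp: B norm_scaleC mult.assoc intro!: mult_left_mono norm_blinfun)
    show "norm (?g c f) = cmod c * norm f"
    proof (cases "c = 0")
      case True
      then show ?thesis using le[of c f] by simp
    next
      case False
      have "f = ?g (inverse c) (?g c f)"
        using False by (intro blinfun_eqI, simp only: B, simp add: scaleC_scaleC scaleC_one blinfun_apply_inverse)
      then have "norm f \<le> cmod (inverse c) * norm (?g c f)" using le by metis
      then have "cmod c * norm f \<le> norm (?g c f)"
        using False by (simp add: norm_inverse norm_divide field_simps)
      with le[of c f] show ?thesis by simp
    qed
  qed
qed

end

lemma cblinfun_apply_simps [simp]:
  "cblinfun_apply 0 x = 0"
  "cblinfun_apply (S + T) x = cblinfun_apply S x + cblinfun_apply T x"
  "cblinfun_apply (S - T) x = cblinfun_apply S x - cblinfun_apply T x"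
  "cblinfun_apply (- T) x = - cblinfun_apply T x"
  "cblinfun_apply (c *\<^sub>C T) x = c *\<^sub>C cblinfun_apply T x"
  unfolding cblinfun_apply_def
  by (simp_all add: zero_cblinfun.rep_eq plus_cblinfun.rep_eq minus_cblinfun.rep_eq
      uminus_cblinfun.rep_eq scaleC_cblinfun.rep_eq blinfun.add_left blinfun.diff_left
      blinfun.minus_left bounded_linear_Blinfun_apply[OF scaleC_blinfun_aux])

lemma norm_cblinfun_apply: "norm (cblinfun_apply T x) \<le> norm T * norm x"
  unfolding cblinfun_apply_def norm_cblinfun.rep_eq by (rule norm_blinfun)

lemma norm_cblinfun_eq_onorm: "norm T = onorm (cblinfun_apply T)"
  unfolding cblinfun_apply_def norm_cblinfun.rep_eq norm_blinfun.rep_eq ..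

lemma norm_cblinfun_bound:
  "0 \<le> b \<Longrightarrow> (\<And>x. norm (cblinfun_apply T x) \<le> b * norm x) \<Longrightarrow> norm T \<le> b"
  unfolding cblinfun_apply_def norm_cblinfun.rep_eq by (rule norm_blinfun_bound)

instance cblinfun :: (complex_normed_vector, cbanach) cbanach
proof
  fix X :: "nat \<Rightarrow> 'a \<Rightarrow>\<^sub>C\<^sub>L 'b"
  assume "Cauchy X"
  have dist: "dist (blinfun_of_cblinfun S) (blinfun_of_cblinfun T) = dist S T"
    for S T :: "'a \<Rightarrow>\<^sub>C\<^sub>L 'b"
    by (simp add: dist_norm norm_cblinfun.rep_eq minus_cblinfun.rep_eq)
  have "Cauchy (\<lambda>n. blinfun_of_cblinfun (X n))"
    using \<open>Cauchy X\<close> by (simp add: Cauchy_def dist)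
  then obtain f where f: "(\<lambda>n. blinfun_of_cblinfun (X n)) \<longlonglongrightarrow> f"
    by (auto simp: Cauchy_convergent_iff convergent_def)
  have lim: "(\<lambda>n. blinfun_apply (blinfun_of_cblinfun (X n)) x) \<longlonglongrightarrow> blinfun_apply f x" for x
    by (intro blinfun.tendsto f tendsto_const)
  have "blinfun_apply f (c *\<^sub>C x) = c *\<^sub>C blinfun_apply f x" for c x
  proof (rule LIMSEQ_unique[OF lim])
    have bl: "bounded_linear (\<lambda>y :: 'b. c *\<^sub>C y)"
      using scaleC_blinfun_aux[of c "id_blinfun :: 'b \<Rightarrow>\<^sub>L 'b"] by simp
    show "(\<lambda>n. blinfun_apply (blinfun_of_cblinfun (X n)) (c *\<^sub>C x))
        \<longlonglongrightarrow> c *\<^sub>C blinfun_apply f x"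
      using bounded_linear.tendsto[OF bl lim[of x]]
      by (simp add: cblinfun_apply_scaleC[unfolded cblinfun_apply_def])
  qed
  then have "blinfun_of_cblinfun (cblinfun_of_blinfun f) = f"
    by (simp add: cblinfun_of_blinfun_inverse)
  then have "X \<longlonglongrightarrow> cblinfun_of_blinfun f"
    using f unfolding tendsto_dist_iff[of _ f] tendsto_dist_iff[of X]
    by (simp flip: dist)
  then show "convergent X" by (auto simp: convergent_def)
qed

lift_definition cblinfun_compose ::
  "('b::complex_normed_vector \<Rightarrow>\<^sub>C\<^sub>L 'c::complex_normed_vector) \<Rightarrow>
   ('a::complex_normed_vector \<Rightarrow>\<^sub>C\<^sub>L 'b) \<Rightarrow> ('a \<Rightarrow>\<^sub>C\<^sub>L 'c)"  (infixl \<open>o\<^sub>C\<^sub>L\<close> 67)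
  is blinfun_compose
  by simp

lift_definition id_cblinfun :: "'a::complex_normed_vector \<Rightarrow>\<^sub>C\<^sub>L 'a" is id_blinfun by simp

lemma cblinfun_apply_compose [simp]:
  "cblinfun_apply (S o\<^sub>C\<^sub>L T) x = cblinfun_apply S (cblinfun_apply T x)"
  by (simp add: cblinfun_apply_def cblinfun_compose.rep_eq)

lemma cblinfun_apply_id [simp]: "cblinfun_apply id_cblinfun x = x"
  by (simp add: cblinfun_apply_def id_cblinfun.rep_eq)

definition CBlinfun :: "('a::complex_normed_vector \<Rightarrow> 'b::complex_normed_vector) \<Rightarrow> ('a \<Rightarrow>\<^sub>C\<^sub>L 'b)"
  where "CBlinfun f = cblinfun_of_blinfun (Blinfun f)"

lemma cblinfun_apply_CBlinfun:
  assumes "bounded_linear f" "\<And>c x. f (c *\<^sub>C x) = c *\<^sub>C f x"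
  shows "cblinfun_apply (CBlinfun f) = f"
  using assms
  by (simp add: cblinfun_apply_def CBlinfun_def cblinfun_of_blinfun_inverse
      bounded_linear_Blinfun_apply)

section \<open>Left and right multiplication operators\<close>

definition left_mult :: "('a::cbanach \<Rightarrow>\<^sub>C\<^sub>L 'a) \<Rightarrow> (('a \<Rightarrow>\<^sub>C\<^sub>L 'a) \<Rightarrow>\<^sub>C\<^sub>L ('a \<Rightarrow>\<^sub>C\<^sub>L 'a))"
  where "left_mult A = CBlinfun (\<lambda>T. A o\<^sub>C\<^sub>L T)"

definition right_mult :: "('a::cbanach \<Rightarrow>\<^sub>C\<^sub>L 'a) \<Rightarrow> (('a \<Rightarrow>\<^sub>C\<^sub>L 'a) \<Rightarrow>\<^sub>C\<^sub>L ('a \<Rightarrow>\<^sub>C\<^sub>L 'a))"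
  where "right_mult A = CBlinfun (\<lambda>T. T o\<^sub>C\<^sub>L A)"

lemma norm_cblinfun_compose: "norm (S o\<^sub>C\<^sub>L T) \<le> norm S * norm T"
  unfolding norm_cblinfun.rep_eq cblinfun_compose.rep_eq by (rule norm_blinfun_compose)

lemma cblinfun_compose_scaleC_right: "S o\<^sub>C\<^sub>L (c *\<^sub>C T) = c *\<^sub>C (S o\<^sub>C\<^sub>L T)"
  by (rule cblinfun_eqI) (simp add: cblinfun_apply_scaleC)

lemma cblinfun_compose_scaleC_left: "(c *\<^sub>C S) o\<^sub>C\<^sub>L T = c *\<^sub>C (S o\<^sub>C\<^sub>L T)"
  by (rule cblinfun_eqI) simp

lemma cblinfun_apply_left_mult [simp]: "cblinfun_apply (left_mult A) T = A o\<^sub>C\<^sub>L T"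
proof -
  have "bounded_linear (\<lambda>T. A o\<^sub>C\<^sub>L T)"
  proof (rule bounded_linear_intro[where K = "norm A"])
    show "norm (A o\<^sub>C\<^sub>L T) \<le> norm T * norm A" for T
      by (metis norm_cblinfun_compose mult.commute)
  qed (auto intro!: cblinfun_eqI simp: scaleR_eq_scaleC cblinfun_compose_scaleC_right
      linear_add[OF bounded_linear.linear[OF bounded_linear_cblinfun_apply]])
  from fun_cong[OF cblinfun_apply_CBlinfun[OF this cblinfun_compose_scaleC_right]]
  show ?thesis
    unfolding left_mult_def .
qed

lemma cblinfun_apply_right_mult [simp]: "cblinfun_apply (right_mult A) T = T o\<^sub>C\<^sub>L A"
proof -
  have "bounded_linear (\<lambda>T. T o\<^sub>C\<^sub>L A)"
    by (rule bounded_linear_intro[where K = "norm A"])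
      (auto intro!: cblinfun_eqI norm_cblinfun_compose
        simp: scaleR_eq_scaleC cblinfun_compose_scaleC_left)
  from fun_cong[OF cblinfun_apply_CBlinfun[OF this cblinfun_compose_scaleC_left]]
  show ?thesis
    unfolding right_mult_def .
qed

section \<open>Dimension and quotient dimension\<close>

text \<open>The library's dimension is a natural number, with junk value 0 in the
  infinite-dimensional case; here that case is \<open>\<infinity>\<close>. Meant for subspaces \<open>V\<close> only.\<close>

definition cdim :: "'a::complex_normed_vector set \<Rightarrow> enat"
  where "cdim V = (if \<exists>B. finite B \<and> cvec.span B = V then enat (cvec.dim V) else \<infinity>)"

text \<open>For a subspace \<open>W\<close>, the quotient by \<open>W\<close> is the set of cosets \<open>x +o W\<close>. Addition of cosets is
  elementwise addition of sets, the zero is \<open>W\<close>, and \<open>c\<close> times a coset \<open>P\<close> is \<open>c *\<^sub>C ` P + W\<close>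
  (adding \<open>W\<close> only matters for \<open>c = 0\<close>, where the elementwise product is \<open>{0}\<close>). The quotient is not
  a type, so its bases are spelled out: a finite basis is a list of cosets of which every coset is
  a linear combination in a unique way.\<close>

definition quotient_space :: "'a::complex_normed_vector set \<Rightarrow> 'a set set"
  where "quotient_space W = range (\<lambda>x. x +o W)"

definition coset_scaleC :: "'a::complex_normed_vector set \<Rightarrow> complex \<Rightarrow> 'a set \<Rightarrow> 'a set"
  where "coset_scaleC W c P = (\<lambda>x. c *\<^sub>C x) ` P + W"

definition coset_lincomb ::
  "'a::complex_normed_vector set \<Rightarrow> complex list \<Rightarrow> 'a set list \<Rightarrow> 'a set"
  where "coset_lincomb W cs Ps = foldr (+) (map2 (coset_scaleC W) cs Ps) W"

definition quotient_basis :: "'a::complex_normed_vector set \<Rightarrow> 'a set list \<Rightarrow> bool"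
  where "quotient_basis W Ps \<longleftrightarrow> set Ps \<subseteq> quotient_space W \<and>
    (\<forall>P\<in>quotient_space W. \<exists>!cs. length cs = length Ps \<and> coset_lincomb W cs Ps = P)"

definition quotient_dim :: "'a::complex_normed_vector set \<Rightarrow> enat"
  where "quotient_dim W =
    (if \<exists>Ps. quotient_basis W Ps then enat (length (SOME Ps. quotient_basis W Ps)) else \<infinity>)"

lemma coset_add:
  assumes "cvec.subspace W"
  shows "(x +o W) + (y +o W) = (x + y) +o W"
proof (intro set_eqI iffI)
  fix z assume "z \<in> (x +o W) + (y +o W)"
  then obtain u v where "u \<in> W" "v \<in> W" "z = (x + u) + (y + v)"
    by (auto simp: elt_set_plus_def set_plus_def)
  then show "z \<in> (x + y) +o W"
    using cvec.subspace_add[OF assms, of u v]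
    by (auto simp: elt_set_plus_def algebra_simps intro!: bexI[of _ "u + v"])
next
  fix z assume "z \<in> (x + y) +o W"
  then obtain u where u: "u \<in> W" "z = (x + u) + (y + 0)"
    by (auto simp: elt_set_plus_def algebra_simps)
  then show "z \<in> (x +o W) + (y +o W)"
    using cvec.subspace_0[OF assms] unfolding elt_set_plus_def set_plus_def by blast
qed

lemma coset_scaleC_coset:
  assumes "cvec.subspace W"
  shows "coset_scaleC W c (x +o W) = (c *\<^sub>C x) +o W"
proof (intro set_eqI iffI)
  fix z assume "z \<in> coset_scaleC W c (x +o W)"
  then obtain u v where "u \<in> W" "v \<in> W" "z = c *\<^sub>C x + (c *\<^sub>C u + v)"
    by (auto simp: coset_scaleC_def elt_set_plus_def set_plus_def scaleC_add_right add.assoc)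
  then show "z \<in> (c *\<^sub>C x) +o W"
    using cvec.subspace_add[OF assms cvec.subspace_scale[OF assms, of u c], of v]
    by (auto simp: elt_set_plus_def)
next
  fix z assume "z \<in> (c *\<^sub>C x) +o W"
  then obtain v where v: "v \<in> W" "z = c *\<^sub>C (x + 0) + v"
    by (auto simp: elt_set_plus_def)
  then show "z \<in> coset_scaleC W c (x +o W)"
    using cvec.subspace_0[OF assms]
    unfolding coset_scaleC_def elt_set_plus_def set_plus_def by blast
qed

lemma coset_lincomb_coset:
  assumes "cvec.subspace W" "length cs = length xs"
  shows "coset_lincomb W cs (map (\<lambda>x. x +o W) xs) = sum_list (map2 (*\<^sub>C) cs xs) +o W"
  using assms(2)
proof (induction cs xs rule: list_induct2)
  case Nil
  show ?case by (simp add: coset_lincomb_def elt_set_plus_def)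
next
  case (Cons c cs x xs)
  then show ?case
    by (simp add: coset_lincomb_def coset_scaleC_coset[OF assms(1)] coset_add[OF assms(1)])
qed

lemma quotient_dim_eq_0_iff:
  assumes "cvec.subspace W"
  shows "quotient_dim W = 0 \<longleftrightarrow> W = UNIV"
proof
  assume "quotient_dim W = 0"
  then have ex: "\<exists>Ps. quotient_basis W Ps" and "length (SOME Ps. quotient_basis W Ps) = 0"
    by (auto simp: quotient_dim_def zero_enat_def split: if_splits)
  then have "quotient_basis W []" using someI_ex[OF ex] by simp
  then have "x +o W = W" for x
    by (auto simp: quotient_basis_def quotient_space_def coset_lincomb_def)
  moreover have "x \<in> x +o W" for x
    using cvec.subspace_0[OF assms] by (force simp: elt_set_plus_def)
  ultimately show "W = UNIV" by blast
next
  assume W: "W = UNIV"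
  have "x +o W = W" for x
    using W by (auto simp: elt_set_plus_def intro!: exI[of _ "_ - x"])
  then have q: "quotient_space W = {W}" by (auto simp: quotient_space_def)
  have "quotient_basis W []" by (simp add: quotient_basis_def q coset_lincomb_def)
  moreover have "Ps = []" if "quotient_basis W Ps" for Ps
  proof (rule ccontr)
    assume "Ps \<noteq> []"
    have *: "coset_lincomb W cs Ps = W" if "length cs = length Ps" for cs
    proof -
      have "Ps = map (\<lambda>x. x +o W) (map (\<lambda>_. 0) Ps)"
        using \<open>quotient_basis W Ps\<close> \<open>\<And>x. x +o W = W\<close>
        by (auto simp: quotient_basis_def q intro!: map_idI[symmetric])
      then show ?thesis
        using coset_lincomb_coset[OF assms, of cs "map (\<lambda>_. 0) Ps"] that
          \<open>\<And>x. x +o W = W\<close> by (metis length_map)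
    qed
    have "\<exists>!cs. length cs = length Ps \<and> coset_lincomb W cs Ps = W"
      using that by (simp add: quotient_basis_def q)
    with * have "replicate (length Ps) 0 = replicate (length Ps) (1::complex)"
      by (metis length_replicate)
    with \<open>Ps \<noteq> []\<close> show False by simp
  qed
  ultimately have "(SOME Ps. quotient_basis W Ps) = []" by (metis someI)
  with \<open>quotient_basis W []\<close> show "quotient_dim W = 0"
    by (auto simp: quotient_dim_def zero_enat_def)
qed

section \<open>Weyl operators and Weyl's theorem\<close>

definition null_space :: "('a::cbanach \<Rightarrow>\<^sub>C\<^sub>L 'a) \<Rightarrow> 'a set"
  where "null_space T = {x. T x = 0}"

definition nullity :: "('a::cbanach \<Rightarrow>\<^sub>C\<^sub>L 'a) \<Rightarrow> enat"
  where "nullity T = cdim (null_space T)"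

definition deficiency :: "('a::cbanach \<Rightarrow>\<^sub>C\<^sub>L 'a) \<Rightarrow> enat"
  where "deficiency T = quotient_dim (range T)"

definition op_minus_scalar :: "('a::cbanach \<Rightarrow>\<^sub>C\<^sub>L 'a) \<Rightarrow> complex \<Rightarrow> ('a \<Rightarrow>\<^sub>C\<^sub>L 'a)"
  where "op_minus_scalar T \<mu> = T - \<mu> *\<^sub>C id_cblinfun"

definition op_invertible :: "('a::cbanach \<Rightarrow>\<^sub>C\<^sub>L 'a) \<Rightarrow> bool"
  where "op_invertible T \<longleftrightarrow> (\<exists>S. S o\<^sub>C\<^sub>L T = id_cblinfun \<and> T o\<^sub>C\<^sub>L S = id_cblinfun)"

definition spectrum :: "('a::cbanach \<Rightarrow>\<^sub>C\<^sub>L 'a) \<Rightarrow> complex set"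
  where "spectrum T = {\<mu>. \<not> op_invertible (op_minus_scalar T \<mu>)}"

definition is_weyl :: "('a::cbanach \<Rightarrow>\<^sub>C\<^sub>L 'a) \<Rightarrow> bool"
  where "is_weyl T \<longleftrightarrow> nullity T = deficiency T \<and> nullity T < \<infinity>"

definition weyl_spectrum :: "('a::cbanach \<Rightarrow>\<^sub>C\<^sub>L 'a) \<Rightarrow> complex set"
  where "weyl_spectrum T = {\<mu>. \<not> is_weyl (op_minus_scalar T \<mu>)}"

definition E0 :: "('a::cbanach \<Rightarrow>\<^sub>C\<^sub>L 'a) \<Rightarrow> complex set"
  where "E0 T = {\<mu>. \<mu> isolated_in spectrum T \<and>
    0 < nullity (op_minus_scalar T \<mu>) \<and> nullity (op_minus_scalar T \<mu>) < \<infinity>}"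

definition weyls_theorem_holds :: "('a::cbanach \<Rightarrow>\<^sub>C\<^sub>L 'a) \<Rightarrow> bool"
  where "weyls_theorem_holds T \<longleftrightarrow> weyl_spectrum T = spectrum T - E0 T"

end

theory Submission
  imports Defs
begin

text \<open>
  Since \<open>L\<^sub>A - \<mu>\<close> is left multiplication by \<open>B = A - \<mu>\<close>, and likewise on the right, everything is
  about a single multiplication operator \<open>L\<^sub>B\<close> or \<open>R\<^sub>B\<close>. Two facts carry the proof.

  The null space of such an operator is zero or infinite-dimensional. It is the annihilator of
  \<open>B\<close>: the operators \<open>T\<close> with \<open>BT = 0\<close>, respectively \<open>TB = 0\<close>. If \<open>BT = 0\<close> and \<open>T \<noteq> 0\<close>, some
  \<open>x \<noteq> 0\<close> in the range of \<open>T\<close> satisfies \<open>B x = 0\<close>, and all operators \<open>z \<mapsto> f(z) x\<close> with \<open>f\<close> in the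
  dual space annihilate \<open>B\<close>; the dual is infinite-dimensional because it separates points. If
  \<open>TB = 0\<close> and \<open>T \<noteq> 0\<close>, some functional \<open>g = h \<circ> T \<noteq> 0\<close> vanishes on the range of \<open>B\<close>, and all
  operators \<open>z \<mapsto> g(z) u\<close> with \<open>u\<close> in the space annihilate \<open>B\<close>. These are the lemmas
  \<open>nullity_left_mult\<close> and \<open>nullity_right_mult\<close>. The empty sets \<open>E\<^sub>0\<close> follow at once, since no
  nullity is finite and positive.

  A bijective multiplication operator is invertible, and its inverse is again a multiplication
  operator. Surjectivity of \<open>L\<^sub>B\<close> yields \<open>S\<close> with \<open>BS = I\<close>; then \<open>B(SB) = BI\<close>, so \<open>SB = I\<close> by
  injectivity, and \<open>L\<^sub>S\<close> is the inverse. A Weyl multiplication operator has finite nullity, hence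
  nullity zero, hence deficiency zero, so it is bijective and therefore invertible; thus the Weyl
  spectrum is the whole spectrum, which is Weyl's theorem when \<open>E\<^sub>0\<close> is empty.

  The analytic input is that the bounded functionals on a normed space separate points. It is
  derived from the fact that a minimal sublinear functional is linear, together with Zorn's lemma.
\<close>

section \<open>Separating points by bounded functionals\<close>

text \<open>Homogeneity is required for positive factors only; the value at \<open>0\<close> is then forced to be \<open>0\<close>.\<close>

definition sublinear :: "('a::real_vector \<Rightarrow> real) \<Rightarrow> bool"
  where "sublinear p \<longleftrightarrow> (\<forall>x y. p (x + y) \<le> p x + p y) \<and> (\<forall>r x. 0 < r \<longrightarrow> p (r *\<^sub>R x) = r * p x)"

lemma sublinear_add: "sublinear p \<Longrightarrow> p (x + y) \<le> p x + p y"
  and sublinear_scaleR: "sublinear p \<Longrightarrow> 0 < r \<Longrightarrow> p (r *\<^sub>R x) = r * p x"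
  by (auto simp: sublinear_def)

lemma sublinear_0:
  assumes "sublinear p" shows "p 0 = 0"
  using sublinear_scaleR[OF assms, of 2 0] by simp

lemma sublinear_minus_le:
  assumes "sublinear p" shows "- p (- x) \<le> p x"
  using sublinear_add[OF assms, of x "- x"] sublinear_0[OF assms] by simp

text \<open>One inequality suffices for homogeneity, because it can also be applied to the inverse
  factor. For functionals defined as infima it is the easy one.\<close>

lemma sublinearI:
  assumes add: "\<And>x y. p (x + y) \<le> p x + p y"
    and scale: "\<And>r x. 0 < r \<Longrightarrow> p (r *\<^sub>R x) \<le> r * p x"
  shows "sublinear p"
proof -
  have "p (r *\<^sub>R x) = r * p x" if "0 < r" for r x
    using scale[OF that, of x] scale[of "inverse r" "r *\<^sub>R x"] that
    by (simp add: field_simps)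
  with add show ?thesis by (simp add: sublinear_def)
qed

text \<open>The functional \<open>q\<close> is \<open>p\<close> lowered along the ray of \<open>y\<close>: \<open>q(x)\<close> is the infimum of
  \<open>p(x + t y) - t p(y)\<close> over \<open>t \<ge> 0\<close>, which is bounded below by \<open>- p(- x)\<close>. The lemma serves twice:
  it shows that minimal sublinear functionals are additive, and, applied to the norm, it makes
  sure that the linear functional found below is nonzero at \<open>y\<close>.\<close>

lemma sublinear_tilt:
  fixes p :: "'a::real_vector \<Rightarrow> real"
  assumes p: "sublinear p"
  obtains q where "sublinear q" "q \<le> p" "\<And>x. q x \<le> p (x + y) - p y"
proof -
  define q where "q x = (INF t\<in>{0..}. p (x + t *\<^sub>R y) - t * p y)" for x
  have hom: "p (t *\<^sub>R y) = t * p y" if "0 \<le> t" for t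
    using that sublinear_scaleR[OF p, of t y] sublinear_0[OF p] by (cases "t = 0") auto
  have bdd: "bdd_below ((\<lambda>t. p (x + t *\<^sub>R y) - t * p y) ` {0..})" for x
  proof (rule bdd_belowI2[where m = "- p (- x)"])
    fix t :: real assume "t \<in> {0..}"
    then show "- p (- x) \<le> p (x + t *\<^sub>R y) - t * p y"
      using sublinear_add[OF p, of "x + t *\<^sub>R y" "- x"] hom[of t] by simp
  qed
  have le: "q x \<le> p (x + t *\<^sub>R y) - t * p y" if "0 \<le> t" for x t
    unfolding q_def using that by (intro cINF_lower bdd) auto
  have ge: "m \<le> q x" if "\<And>t. 0 \<le> t \<Longrightarrow> m \<le> p (x + t *\<^sub>R y) - t * p y" for m x
    unfolding q_def using that by (intro cINF_greatest) auto
  have "sublinear q"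
  proof (rule sublinearI)
    fix x z
    have 1: "q (x + z) \<le> (p (x + s *\<^sub>R y) - s * p y) + (p (z + t *\<^sub>R y) - t * p y)"
      if "0 \<le> s" "0 \<le> t" for s t
      using le[of "s + t" "x + z"] that sublinear_add[OF p, of "x + s *\<^sub>R y" "z + t *\<^sub>R y"]
      by (simp add: algebra_simps)
    have "q (x + z) - (p (z + t *\<^sub>R y) - t * p y) \<le> q x" if "0 \<le> t" for t
      using 1 that by (intro ge) (smt (verit))
    then have "q (x + z) - q x \<le> q z"
      by (intro ge) (smt (verit))
    then show "q (x + z) \<le> q x + q z" by simp
  next
    fix r :: real and x assume r: "0 < r"
    have "q (r *\<^sub>R x) / r \<le> q x"
    proof (rule ge)
      fix t :: real assume t: "0 \<le> t"
      have "q (r *\<^sub>R x) \<le> p (r *\<^sub>R (x + t *\<^sub>R y)) - r * t * p y"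
        using le[of "r * t" "r *\<^sub>R x"] r t by (simp add: scaleR_add_right)
      also have "\<dots> = r * (p (x + t *\<^sub>R y) - t * p y)"
        using sublinear_scaleR[OF p r, of "x + t *\<^sub>R y"] by (simp add: right_diff_distrib)
      finally show "q (r *\<^sub>R x) / r \<le> p (x + t *\<^sub>R y) - t * p y"
        using r by (simp add: field_simps)
    qed
    then show "q (r *\<^sub>R x) \<le> r * q x" using r by (simp add: field_simps)
  qed
  moreover have "q \<le> p" using le[of 0] by (simp add: le_fun_def)
  moreover have "q x \<le> p (x + y) - p y" for x using le[of 1 x] by simp
  ultimately show thesis by (rule that)
qed

text \<open>Lowering \<open>p\<close> along \<open>y\<close> cannot change a minimal \<open>p\<close>, so \<open>p(x) \<le> p(x + y) - p(y)\<close>, which is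
  the missing half of additivity.\<close>

lemma minimal_sublinear_linear:
  fixes p :: "'a::real_vector \<Rightarrow> real"
  assumes p: "sublinear p" and min: "\<And>q. sublinear q \<Longrightarrow> q \<le> p \<Longrightarrow> q = p"
  shows "linear p"
proof -
  have add: "p (x + y) = p x + p y" for x y
  proof -
    obtain q where "sublinear q" "q \<le> p" "q x \<le> p (x + y) - p y"
      using sublinear_tilt[OF p] by metis
    with min[of q] sublinear_add[OF p, of x y] show ?thesis by force
  qed
  have neg: "p (- x) = - p x" for x
    using add[of x "- x"] sublinear_0[OF p] by simp
  have "p (r *\<^sub>R x) = r * p x" for r x
    using sublinear_scaleR[OF p, of r x] sublinear_scaleR[OF p, of "- r" x] sublinear_0[OF p] neg
    by (cases r "0::real" rule: linorder_cases) auto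
  with add show ?thesis by (intro linearI) auto
qed

text \<open>The chain condition is what makes the infimum subadditive: two members \<open>p\<close> and \<open>q\<close>, applied
  to different summands, can be replaced by the smaller of them.\<close>

lemma sublinear_INF:
  fixes C :: "('a::real_vector \<Rightarrow> real) set"
  assumes "C \<noteq> {}" and sub: "\<And>p. p \<in> C \<Longrightarrow> sublinear p"
    and chain: "\<And>p q. p \<in> C \<Longrightarrow> q \<in> C \<Longrightarrow> p \<le> q \<or> q \<le> p"
    and bdd: "\<And>x. bdd_below ((\<lambda>p. p x) ` C)"
  shows "sublinear (\<lambda>x. INF p\<in>C. p x)"
proof (rule sublinearI)
  let ?m = "\<lambda>x. INF p\<in>C. p x"
  have le: "?m x \<le> p x" if "p \<in> C" for p x
    using that by (intro cINF_lower bdd)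
  have ge: "m \<le> ?m x" if "\<And>p. p \<in> C \<Longrightarrow> m \<le> p x" for m x
    using that by (intro cINF_greatest \<open>C \<noteq> {}\<close>)
  fix x y
  have 1: "?m (x + y) \<le> p x + q y" if "p \<in> C" "q \<in> C" for p q
  proof -
    obtain r where "r \<in> C" "r \<le> p" "r \<le> q"
      using chain[OF \<open>p \<in> C\<close> \<open>q \<in> C\<close>] \<open>p \<in> C\<close> \<open>q \<in> C\<close> by (meson order_refl)
    then show ?thesis
      using le[of r "x + y"] sublinear_add[OF sub, of r x y] le_funD[of r p x] le_funD[of r q y]
      by linarith
  qed
  have "?m (x + y) - q y \<le> ?m x" if "q \<in> C" for q
    using 1 that by (intro ge) (smt (verit))
  then have "?m (x + y) - ?m x \<le> ?m y"
    by (intro ge) (smt (verit))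
  then show "?m (x + y) \<le> ?m x + ?m y" by simp
next
  let ?m = "\<lambda>x. INF p\<in>C. p x"
  fix r :: real and x assume r: "0 < r"
  have "?m (r *\<^sub>R x) / r \<le> ?m x"
  proof (rule cINF_greatest[OF \<open>C \<noteq> {}\<close>])
    fix p assume "p \<in> C"
    then have "?m (r *\<^sub>R x) \<le> p (r *\<^sub>R x)" by (intro cINF_lower bdd)
    then show "?m (r *\<^sub>R x) / r \<le> p x"
      using sublinear_scaleR[OF sub[OF \<open>p \<in> C\<close>] r, of x] r by (simp add: field_simps)
  qed
  then show "?m (r *\<^sub>R x) \<le> r * ?m x" using r by (simp add: field_simps)
qed

text \<open>Zorn's lemma gives a minimal sublinear functional below \<open>p\<close>. A chain below \<open>p\<close> has a
  pointwise infimum because every \<open>q \<le> p\<close> satisfies \<open>q(x) \<ge> - q(- x) \<ge> - p(- x)\<close>.\<close>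

lemma exists_linear_below_sublinear:
  fixes p :: "'a::real_vector \<Rightarrow> real"
  assumes p: "sublinear p"
  obtains f where "linear f" "f \<le> p"
proof -
  define S where "S = {q. sublinear q \<and> q \<le> p}"
  have "\<exists>m\<in>S. \<forall>q\<in>S. m \<ge> q \<longrightarrow> q = m"
  proof (rule predicate_Zorn)
    show "partial_order_on S (relation_of (\<ge>) S)"
      by (rule partial_order_on_relation_ofI) auto
    fix C assume C: "C \<in> Chains (relation_of (\<ge>) S)"
    then have CS: "C \<subseteq> S" and chain: "\<And>q r. q \<in> C \<Longrightarrow> r \<in> C \<Longrightarrow> q \<le> r \<or> r \<le> q"
      by (auto simp: Chains_def relation_of_def)
    show "\<exists>u\<in>S. \<forall>q\<in>C. q \<ge> u"
    proof (cases "C = {}")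
      case True
      with p show ?thesis by (auto simp: S_def)
    next
      case False
      have lb: "- p (- x) \<le> q x" if "q \<in> C" for q x
        proof -
        have "sublinear q" "q (- x) \<le> p (- x)"
          using that CS by (auto simp: S_def le_fun_def)
        with sublinear_minus_le[of q x] show ?thesis by linarith
      qed
      have bdd: "bdd_below ((\<lambda>q. q x) ` C)" for x
        using lb by (intro bdd_belowI2[where m = "- p (- x)"])
      let ?m = "\<lambda>x. INF q\<in>C. q x"
      have le: "?m \<le> q" if "q \<in> C" for q
        using that by (intro le_funI cINF_lower bdd)
      have "sublinear ?m"
        using CS by (intro sublinear_INF False chain bdd) (auto simp: S_def)
      moreover have "?m \<le> p"
        using False le CS by (force simp: S_def intro: order_trans)
      ultimately show ?thesis using le by (auto simp: S_def)
    qed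
  qed
  then obtain f where "sublinear f" "f \<le> p" "\<And>q. sublinear q \<Longrightarrow> q \<le> f \<Longrightarrow> q = f"
    unfolding S_def by (blast intro: order_trans)
  then show thesis using that minimal_sublinear_linear by metis
qed

lemma exists_real_functional_nonzero:
  fixes y :: "'a::real_normed_vector"
  assumes "y \<noteq> 0"
  obtains f :: "'a \<Rightarrow> real" where "bounded_linear f" "f y \<noteq> 0"
proof -
  have "sublinear (norm :: 'a \<Rightarrow> real)" by (simp add: sublinear_def norm_triangle_ineq)
  then obtain q where q: "sublinear q" "q \<le> norm" "\<And>x. q x \<le> norm (x + y) - norm y"
    using sublinear_tilt by metis
  obtain f where f: "linear f" "f \<le> q"
    using exists_linear_below_sublinear[OF q(1)] .
  \<comment> \<open>Being below the norm makes \<open>f\<close> bounded; being below the lowered norm \<open>q\<close> gives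
    \<open>f(- y) \<le> q(- y) \<le> - norm y < 0\<close>.\<close>
  have le: "f x \<le> norm x" for x
    using f(2) q(2) by (meson le_funD order_trans)
  have "\<bar>f x\<bar> \<le> norm x" for x
    using le[of x] le[of "- x"] linear_neg[OF f(1), of x] by simp
  then have "bounded_linear f"
    using f(1) by (intro bounded_linear_intro[where K = 1]) (auto simp: linear_add linear_cmul)
  moreover have "f (- y) \<le> - norm y"
    using le_funD[OF f(2), of "- y"] q(3)[of "- y"] by simp
  then have "f y \<noteq> 0" using assms linear_neg[OF f(1), of y] by auto
  ultimately show thesis by (rule that)
qed

lemma bounded_linear_scaleC_right: "bounded_linear (\<lambda>x. c *\<^sub>C x :: 'a::complex_normed_vector)"
  using scaleC_blinfun_aux[of c "id_blinfun :: 'a \<Rightarrow>\<^sub>L 'a"] by simp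

text \<open>The complexification \<open>x \<mapsto> f(x) - \<i> f(\<i> x)\<close> of a real functional \<open>f\<close> is complex linear and
  has real part \<open>f\<close>.\<close>

lemma exists_functional_nonzero:
  fixes y :: "'a::complex_normed_vector"
  assumes "y \<noteq> 0"
  obtains g :: "'a \<Rightarrow>\<^sub>C\<^sub>L complex" where "g y \<noteq> 0"
proof -
  obtain f :: "'a \<Rightarrow> real" where f: "bounded_linear f" "f y \<noteq> 0"
    using exists_real_functional_nonzero[OF assms] .
  interpret f: bounded_linear f by fact
  define g where "g x = complex_of_real (f x) - \<i> * complex_of_real (f (\<i> *\<^sub>C x))" for x
  have bl: "bounded_linear g"
    unfolding g_def
    by (intro bounded_linear_sub bounded_linear_const_mult bounded_linear_compose[OF bounded_linear_of_real]
        bounded_linear_compose[OF f(1)] f(1) bounded_linear_scaleC_right)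
  have i: "g (\<i> *\<^sub>C x) = \<i> * g x" for x
    by (simp add: g_def scaleC_scaleC f.neg scaleC_one cvec.scale_minus_left algebra_simps)
  have "g (c *\<^sub>C x) = c * g x" for c x
  proof -
    have "c *\<^sub>C x = Re c *\<^sub>R x + Im c *\<^sub>R (\<i> *\<^sub>C x)"
      by (simp add: scaleR_eq_scaleC scaleC_scaleC flip: scaleC_add_left)
        (metis complex_eq mult.commute)
    then have "g (c *\<^sub>C x) = Re c *\<^sub>R g x + Im c *\<^sub>R (\<i> * g x)"
      by (simp add: bounded_linear.linear[OF bl] linear_add linear_cmul i)
    also have "\<dots> = c * g x"
      by (subst (3) complex_eq[of c]) (simp add: scaleR_conv_of_real algebra_simps)
    finally show ?thesis .
  qed
  then have "cblinfun_apply (CBlinfun g) = g"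
    by (intro cblinfun_apply_CBlinfun bl) (simp add: scaleC_complex_def)
  moreover have "Re (g y) = f y" by (simp add: g_def)
  ultimately show thesis using f(2) by (intro that[of "CBlinfun g"]) force
qed

section \<open>Criteria for finite dimension\<close>

lemma cdim_infinite_iff: "cdim V = \<infinity> \<longleftrightarrow> (\<nexists>B. finite B \<and> cvec.span B = V)"
  by (simp add: cdim_def)

lemma cblinfun_apply_linear:
  "cblinfun_apply T (x + y) = cblinfun_apply T x + cblinfun_apply T y"
  "cblinfun_apply T (x - y) = cblinfun_apply T x - cblinfun_apply T y"
  "cblinfun_apply T 0 = 0"
  using bounded_linear.linear[OF bounded_linear_cblinfun_apply, of T]
  by (simp_all add: linear_add linear_diff linear_0)

lemma null_space_eq_0_iff: "null_space T = {0} \<longleftrightarrow> (\<forall>x. T x = 0 \<longrightarrow> x = 0)"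
  by (auto simp: null_space_def cblinfun_apply_linear)

lemma subspace_range: "cvec.subspace (range (cblinfun_apply T))"
proof (rule cvec.subspaceI)
  show "0 \<in> range (cblinfun_apply T)" by (metis cblinfun_apply_linear(3) rangeI)
next
  fix x y assume "x \<in> range (cblinfun_apply T)" "y \<in> range (cblinfun_apply T)"
  then show "x + y \<in> range (cblinfun_apply T)"
    by (metis (no_types, opaque_lifting) cblinfun_apply_linear(1) rangeE rangeI)
next
  fix c x assume "x \<in> range (cblinfun_apply T)"
  then show "c *\<^sub>C x \<in> range (cblinfun_apply T)"
    by (metis (no_types, opaque_lifting) cblinfun_apply_scaleC rangeE rangeI)
qed

text \<open>Each functional cuts the dimension by at most one, so the induction adds functionals one at
  a time: passing from \<open>V\<close> to \<open>V \<inter> ker g\<close> costs at most one spanning vector. This is why \<open>V\<close> has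
  to vary.\<close>

lemma finite_span_if_joint_kernel_trivial:
  fixes G :: "('a::complex_normed_vector \<Rightarrow>\<^sub>C\<^sub>L complex) set"
  assumes "finite G" "cvec.subspace V" "\<And>v. v \<in> V \<Longrightarrow> (\<And>g. g \<in> G \<Longrightarrow> g v = 0) \<Longrightarrow> v = 0"
  shows "\<exists>B. finite B \<and> cvec.span B = V"
  using assms
proof (induction G arbitrary: V rule: finite_induct)
  case empty
  then have "V = {0}" using cvec.subspace_0 by auto
  then show ?case by (intro exI[of _ "{}"]) simp
next
  case (insert g G)
  note V = \<open>cvec.subspace V\<close>
  let ?W = "{v \<in> V. g v = 0}"
  have W: "cvec.subspace ?W"
    using V by (auto simp: cvec.subspace_def cblinfun_apply_linear cblinfun_apply_scaleC)
  then obtain B where B: "finite B" "cvec.span B = ?W"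
    using insert.IH[OF W] insert.prems(2) by auto
  show ?case
  proof (cases "?W = V")
    case True
    with B show ?thesis by metis
  next
    case False
    then obtain w where w: "w \<in> V" "g w \<noteq> 0" by auto
    have "v \<in> cvec.span (insert w B)" if "v \<in> V" for v
    proof -
      have "v - (g v / g w) *\<^sub>C w \<in> ?W"
        using that w V
        by (auto simp: cblinfun_apply_linear cblinfun_apply_scaleC scaleC_complex_def
            intro!: cvec.subspace_diff cvec.subspace_scale)
      then show ?thesis using B(2) by (auto simp: cvec.span_insert)
    qed
    moreover have "cvec.span (insert w B) \<subseteq> V"
      using w V B cvec.span_superset[of B] by (intro cvec.span_minimal) auto
    ultimately show ?thesis using B(1) by (intro exI[of _ "insert w B"]) auto
  qed
qed

lemma apply_in_subspace_if_in_span: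
  assumes "T \<in> cvec.span F" "cvec.subspace U" "\<And>S. S \<in> F \<Longrightarrow> cblinfun_apply S x \<in> U"
  shows "cblinfun_apply T x \<in> U"
  using assms(1)
proof (rule cvec.span_induct)
  show "cvec.subspace {T. cblinfun_apply T x \<in> U}"
    using assms(2) by (auto simp: cvec.subspace_def)
qed (use assms(3) in auto)

section \<open>Null spaces of multiplication operators\<close>

definition rank_one ::
  "('a::complex_normed_vector \<Rightarrow>\<^sub>C\<^sub>L complex) \<Rightarrow> 'b::complex_normed_vector \<Rightarrow> ('a \<Rightarrow>\<^sub>C\<^sub>L 'b)"
  where "rank_one f x = CBlinfun (\<lambda>z. f z *\<^sub>C x)"

lemma rank_one_apply [simp]: "cblinfun_apply (rank_one f x) z = f z *\<^sub>C x"
proof -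
  have "bounded_linear (\<lambda>z. f z *\<^sub>C x)"
  proof (rule bounded_linear_intro[where K = "norm f * norm x"])
    fix z r
    show "norm (f z *\<^sub>C x) \<le> norm z * (norm f * norm x)"
      using mult_right_mono[OF norm_cblinfun_apply[of f z], of "norm x"]
      by (simp add: norm_scaleC mult_ac)
  qed (simp_all add: cblinfun_apply_linear scaleC_add_left scaleR_eq_scaleC cblinfun_apply_scaleC
      scaleC_scaleC scaleC_complex_def)
  from fun_cong[OF cblinfun_apply_CBlinfun[OF this]] show ?thesis
    unfolding rank_one_def by (simp add: cblinfun_apply_scaleC scaleC_scaleC scaleC_complex_def)
qed

text \<open>Suppose that finitely many operators \<open>F\<close> span the null space, and let \<open>x \<noteq> 0\<close> with
  \<open>B x = 0\<close> and \<open>h(x) \<noteq> 0\<close>. Every \<open>z \<mapsto> f(z) x\<close> is a combination of \<open>F\<close>, so each functional \<open>f\<close> is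
  a combination of the finitely many functionals \<open>h \<circ> S\<close> with \<open>S \<in> F\<close>. These therefore have
  trivial joint kernel, which forces the space to be finite-dimensional.\<close>

lemma nullity_left_mult:
  fixes B :: "'a::cbanach \<Rightarrow>\<^sub>C\<^sub>L 'a"
  assumes inf: "cdim (UNIV :: 'a set) = \<infinity>" and "null_space (left_mult B) \<noteq> {0}"
  shows "nullity (left_mult B) = \<infinity>"
proof (rule ccontr)
  assume "nullity (left_mult B) \<noteq> \<infinity>"
  then obtain F where F: "finite F" "cvec.span F = null_space (left_mult B)"
    by (auto simp: nullity_def cdim_infinite_iff)
  from assms(2) obtain T :: "'a \<Rightarrow>\<^sub>C\<^sub>L 'a" where T: "B o\<^sub>C\<^sub>L T = 0" "T \<noteq> 0"
    by (auto simp: null_space_eq_0_iff)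
  then obtain z where "T z \<noteq> 0" by (metis cblinfun_apply_simps(1) cblinfun_eqI)
  define x where "x = T z"
  have x: "x \<noteq> 0" "B x = 0"
    using \<open>T z \<noteq> 0\<close> T(1) by (auto simp: x_def simp flip: cblinfun_apply_compose)
  obtain h :: "'a \<Rightarrow>\<^sub>C\<^sub>L complex" where h: "h x \<noteq> 0"
    using exists_functional_nonzero[OF x(1)] .
  have "v = 0" if v: "\<And>S. S \<in> F \<Longrightarrow> h (S v) = 0" for v
  proof (rule ccontr)
    assume "v \<noteq> 0"
    then obtain f :: "'a \<Rightarrow>\<^sub>C\<^sub>L complex" where f: "f v \<noteq> 0"
      using exists_functional_nonzero by blast
    have "rank_one f x \<in> cvec.span F"
      unfolding F(2) using x(2)
      by (auto simp: null_space_def cblinfun_apply_scaleC intro!: cblinfun_eqI)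
    then have "rank_one f x v \<in> {y. h y = 0}"
      by (rule apply_in_subspace_if_in_span)
        (auto simp: v cvec.subspace_def cblinfun_apply_linear cblinfun_apply_scaleC)
    with f h show False by (simp add: cblinfun_apply_scaleC scaleC_complex_def)
  qed
  then have "v = 0" if "\<And>g. g \<in> (\<lambda>S. h o\<^sub>C\<^sub>L S) ` F \<Longrightarrow> cblinfun_apply g v = 0" for v
    using that by (metis cblinfun_apply_compose imageI)
  then have "\<exists>C :: 'a set. finite C \<and> cvec.span C = UNIV"
    using finite_span_if_joint_kernel_trivial[of "(\<lambda>S. h o\<^sub>C\<^sub>L S) ` F" UNIV] F(1)
    by (metis cvec.subspace_UNIV finite_imageI)
  with inf show False by (simp add: cdim_infinite_iff)
qed

text \<open>Suppose that finitely many operators \<open>F\<close> span the null space. With \<open>g = h \<circ> T\<close> vanishing on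
  the range of \<open>B\<close> and \<open>g(w) \<noteq> 0\<close>, every \<open>z \<mapsto> g(z) u\<close> is a combination of \<open>F\<close>; evaluating at \<open>w\<close>
  shows that every vector \<open>u\<close> is a combination of the vectors \<open>S w\<close> with \<open>S \<in> F\<close>.\<close>

lemma nullity_right_mult:
  fixes B :: "'a::cbanach \<Rightarrow>\<^sub>C\<^sub>L 'a"
  assumes inf: "cdim (UNIV :: 'a set) = \<infinity>" and "null_space (right_mult B) \<noteq> {0}"
  shows "nullity (right_mult B) = \<infinity>"
proof (rule ccontr)
  assume "nullity (right_mult B) \<noteq> \<infinity>"
  then obtain F where F: "finite F" "cvec.span F = null_space (right_mult B)"
    by (auto simp: nullity_def cdim_infinite_iff)
  from assms(2) obtain T :: "'a \<Rightarrow>\<^sub>C\<^sub>L 'a" where T: "T o\<^sub>C\<^sub>L B = 0" "T \<noteq> 0"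
    by (auto simp: null_space_eq_0_iff)
  then obtain w where "T w \<noteq> 0" by (metis cblinfun_apply_simps(1) cblinfun_eqI)
  then obtain h :: "'a \<Rightarrow>\<^sub>C\<^sub>L complex" where h: "h (T w) \<noteq> 0"
    using exists_functional_nonzero by blast
  let ?C = "(\<lambda>S. cblinfun_apply S w) ` F"
  have TB: "T (B z) = 0" for z using T(1) by (simp flip: cblinfun_apply_compose)
  have "u \<in> cvec.span ?C" for u
  proof -
    have "rank_one (h o\<^sub>C\<^sub>L T) u \<in> cvec.span F"
      unfolding F(2)
      by (auto simp: null_space_def TB cblinfun_apply_linear intro!: cblinfun_eqI)
    then have "rank_one (h o\<^sub>C\<^sub>L T) u w \<in> cvec.span ?C"
      by (rule apply_in_subspace_if_in_span) (auto intro: cvec.span_base)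
    then have "h (T w) *\<^sub>C u \<in> cvec.span ?C" by simp
    then have "inverse (h (T w)) *\<^sub>C (h (T w) *\<^sub>C u) \<in> cvec.span ?C"
      by (rule cvec.span_scale)
    moreover have "inverse (h (T w)) *\<^sub>C (h (T w) *\<^sub>C u) = u"
      using h by (simp only: scaleC_scaleC left_inverse scaleC_one not_False_eq_True)
    ultimately show ?thesis by (simp only:)
  qed
  then have "cvec.span ?C = UNIV" by auto
  with inf F(1) show False by (metis cdim_infinite_iff finite_imageI)
qed

section \<open>Weyl's theorem for multiplication operators\<close>

lemma nullity_eq_0_if:
  assumes "null_space T = {0}" shows "nullity T = 0"
proof -
  have "cvec.dim (null_space T) = 0"
    by (metis assms card.empty cvec.dim_eq_card_independent cvec.dim_span
        cvec.independent_empty cvec.span_empty)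
  moreover have "finite {} \<and> cvec.span {} = null_space T"
    by (simp only: assms cvec.span_empty finite.emptyI simp_thms)
  ultimately show ?thesis
    unfolding nullity_def cdim_def zero_enat_def by metis
qed

lemma null_space_eq_0_iff_inj: "null_space T = {0} \<longleftrightarrow> inj (cblinfun_apply T)"
proof
  assume *: "null_space T = {0}"
  show "inj (cblinfun_apply T)"
  proof (rule injI)
    fix x y assume "T x = T y"
    then have "x - y \<in> null_space T" by (simp add: null_space_def cblinfun_apply_linear)
    with * show "x = y" by simp
  qed
next
  assume "inj (cblinfun_apply T)"
  then show "null_space T = {0}"
    by (auto simp: null_space_def cblinfun_apply_linear dest: injD[of _ _ 0])
qed

text \<open>Under the dichotomy for the nullity, finite nullity means nullity zero, and then the Weyl
  condition says that the deficiency is zero as well.\<close>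

lemma weyl_iff_bij:
  assumes "null_space T \<noteq> {0} \<Longrightarrow> nullity T = \<infinity>"
  shows "is_weyl T \<longleftrightarrow> bij (cblinfun_apply T)"
proof -
  have "is_weyl T \<longleftrightarrow> null_space T = {0} \<and> deficiency T = 0"
  proof (cases "null_space T = {0}")
    case True
    then show ?thesis by (simp add: is_weyl_def nullity_eq_0_if eq_commute[of 0])
  next
    case False
    then show ?thesis using assms by (simp add: is_weyl_def)
  qed
  also have "\<dots> \<longleftrightarrow> inj (cblinfun_apply T) \<and> surj (cblinfun_apply T)"
    unfolding null_space_eq_0_iff_inj deficiency_def quotient_dim_eq_0_iff[OF subspace_range] ..
  finally show ?thesis by (simp only: bij_def)
qed

lemma op_invertible_bij:
  assumes "op_invertible T" shows "bij (cblinfun_apply T)"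
proof -
  obtain S where S: "S o\<^sub>C\<^sub>L T = id_cblinfun" "T o\<^sub>C\<^sub>L S = id_cblinfun"
    using assms by (auto simp: op_invertible_def)
  have "S (T x) = x" "T (S x) = x" for x
    using arg_cong[OF S(1), of "\<lambda>R. cblinfun_apply R x"]
      arg_cong[OF S(2), of "\<lambda>R. cblinfun_apply R x"]
    by simp_all
  then show ?thesis by (intro o_bij[of "cblinfun_apply S"]) auto
qed

lemma weyls_theorem_if_nullity_0_or_infinite:
  assumes nullity: "\<And>\<mu>. null_space (op_minus_scalar T \<mu>) \<noteq> {0} \<Longrightarrow>
      nullity (op_minus_scalar T \<mu>) = \<infinity>"
    and inv: "\<And>\<mu>. bij (cblinfun_apply (op_minus_scalar T \<mu>)) \<Longrightarrow>
      op_invertible (op_minus_scalar T \<mu>)"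
  shows "E0 T = {} \<and> weyls_theorem_holds T"
proof -
  have E0: "E0 T = {}"
  proof -
    have "nullity (op_minus_scalar T \<mu>) = 0 \<or> nullity (op_minus_scalar T \<mu>) = \<infinity>" for \<mu>
      using nullity[of \<mu>] nullity_eq_0_if[of "op_minus_scalar T \<mu>"] by argo
    then show ?thesis unfolding E0_def by (intro Collect_empty_eq[THEN iffD2] allI) (metis less_irrefl)
  qed
  have "is_weyl (op_minus_scalar T \<mu>) \<longleftrightarrow> op_invertible (op_minus_scalar T \<mu>)" for \<mu>
    using weyl_iff_bij[OF nullity, of \<mu>] inv[of \<mu>] op_invertible_bij[of "op_minus_scalar T \<mu>"] by argo
  then have "weyl_spectrum T = spectrum T"
    unfolding weyl_spectrum_def spectrum_def by (simp only:)
  then show ?thesis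
    unfolding weyls_theorem_holds_def E0 by (simp only: Diff_empty simp_thms)
qed

lemma op_minus_scalar_left_mult:
  "op_minus_scalar (left_mult A) \<mu> = left_mult (op_minus_scalar A \<mu>)"
  by (intro cblinfun_eqI) (simp add: op_minus_scalar_def)

lemma op_minus_scalar_right_mult:
  "op_minus_scalar (right_mult A) \<mu> = right_mult (op_minus_scalar A \<mu>)"
  by (intro cblinfun_eqI)
    (simp add: op_minus_scalar_def cblinfun_apply_linear cblinfun_apply_scaleC)

lemma cblinfun_compose_assoc: "(S o\<^sub>C\<^sub>L T) o\<^sub>C\<^sub>L U = S o\<^sub>C\<^sub>L (T o\<^sub>C\<^sub>L U)"
  by (rule cblinfun_eqI) simp

lemma cblinfun_compose_id [simp]: "T o\<^sub>C\<^sub>L id_cblinfun = T" "id_cblinfun o\<^sub>C\<^sub>L T = T"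
  by (auto intro: cblinfun_eqI)

text \<open>Bijectivity makes \<open>B\<close> itself invertible: a preimage \<open>S\<close> of the identity is a right inverse
  of \<open>B\<close>, and also a left inverse, because \<open>L\<^sub>B\<close> maps both \<open>SB\<close> and the identity to \<open>B\<close>.\<close>

lemma op_invertible_left_mult:
  assumes "bij (cblinfun_apply (left_mult B))"
  shows "op_invertible (left_mult B)"
proof -
  obtain S where S: "B o\<^sub>C\<^sub>L S = id_cblinfun"
    using bij_is_surj[OF assms] by (metis cblinfun_apply_left_mult surjD)
  have "left_mult B (S o\<^sub>C\<^sub>L B) = left_mult B id_cblinfun"
    using S by (simp flip: cblinfun_compose_assoc)
  then have S': "S o\<^sub>C\<^sub>L B = id_cblinfun"
    by (rule injD[OF bij_is_inj[OF assms]])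
  have "left_mult S (left_mult B T) = T" "left_mult B (left_mult S T) = T" for T
    by (simp_all add: S S' flip: cblinfun_compose_assoc)
  then show ?thesis
    unfolding op_invertible_def
    by (metis cblinfun_apply_compose cblinfun_apply_id cblinfun_eqI)
qed

lemma op_invertible_right_mult:
  assumes "bij (cblinfun_apply (right_mult B))"
  shows "op_invertible (right_mult B)"
proof -
  obtain S where S: "S o\<^sub>C\<^sub>L B = id_cblinfun"
    using bij_is_surj[OF assms] by (metis cblinfun_apply_right_mult surjD)
  have "right_mult B (B o\<^sub>C\<^sub>L S) = right_mult B id_cblinfun"
    using S by (simp add: cblinfun_compose_assoc)
  then have S': "B o\<^sub>C\<^sub>L S = id_cblinfun"
    by (rule injD[OF bij_is_inj[OF assms]])
  have "right_mult S (right_mult B T) = T" "right_mult B (right_mult S T) = T" for T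
    by (simp_all add: S S' cblinfun_compose_assoc)
  then show ?thesis
    unfolding op_invertible_def
    by (metis cblinfun_apply_compose cblinfun_apply_id cblinfun_eqI)
qed

theorem theorem3p3:
  fixes A :: "'a::cbanach \<Rightarrow>\<^sub>C\<^sub>L 'a"
  assumes "cdim (UNIV :: 'a set) = \<infinity>"
  shows "E0 (left_mult A) = {} \<and> E0 (right_mult A) = {} \<and>
    weyls_theorem_holds (left_mult A) \<and> weyls_theorem_holds (right_mult A)"
proof -
  have "E0 (left_mult A) = {} \<and> weyls_theorem_holds (left_mult A)"
    by (rule weyls_theorem_if_nullity_0_or_infinite; unfold op_minus_scalar_left_mult)
      (fact nullity_left_mult[OF assms] op_invertible_left_mult)+
  moreover have "E0 (right_mult A) = {} \<and> weyls_theorem_holds (right_mult A)"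
    by (rule weyls_theorem_if_nullity_0_or_infinite; unfold op_minus_scalar_right_mult)
      (fact nullity_right_mult[OF assms] op_invertible_right_mult)+
  ultimately show ?thesis by blast
qed

end
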